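(* Every self-adjoint square matrix $H$ over the $*$-algebra $(Cl_{0,1,1}(\mathbb R),*_1)$ described in the context is unitarily diagonalisable: there are a unitary matrix $U$ and a diagonal matrix $D$ over this $*$-algebra with $H=UDU^*$.
   Context: The real associative unital algebra $Cl_{0,1,1}(\mathbb R)$ has elements written uniquely as $w+z\delta$ with $w,z\in\mathbb C$, where multiplication extends that of $\mathbb C$ and is determined by $\delta^2=0$ and $\delta z=\overline z\,\delta$ for $z\in\mathbb C$. The involution is $(w+z\delta)^{*_1}=\overline w+z\delta$. For a matrix $M$, $(M^* )_{ij}=(M_{ji})^{*_1}$; $M$ is self-adjoint if $M^*=M$, and a square matrix $U$ is unitary if $U^*=U^{-1}$. *)

theory Defs
  imports "HOL-Analysis.Analysis"
begin

text \<open>\<open>Cl011 w z\<close> encodes the element \<open>w + z\<delta>\<close>.\<close>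

datatype cl011 = Cl011 (cl_fst: complex) (cl_snd: complex)

text \<open>
  The product is forced by \<open>\<delta>\<^sup>2 = 0\<close> and \<open>\<delta>z = cnj z \<delta>\<close>:
  \<open>(w + z\<delta>)(w' + z'\<delta>) = ww' + wz'\<delta> + z(\<delta>w') + z(\<delta>z')\<delta> = ww' + (wz' + z cnj w')\<delta>\<close>.
\<close>

instantiation cl011 :: real_algebra_1
begin

definition zero_cl011 :: cl011 where "0 = Cl011 0 0"

definition one_cl011 :: cl011 where "1 = Cl011 1 0"

definition plus_cl011 :: "cl011 \<Rightarrow> cl011 \<Rightarrow> cl011" where
  "x + y = Cl011 (cl_fst x + cl_fst y) (cl_snd x + cl_snd y)"

definition uminus_cl011 :: "cl011 \<Rightarrow> cl011" where
  "- x = Cl011 (- cl_fst x) (- cl_snd x)"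

definition minus_cl011 :: "cl011 \<Rightarrow> cl011 \<Rightarrow> cl011" where
  "x - y = Cl011 (cl_fst x - cl_fst y) (cl_snd x - cl_snd y)"

definition scaleR_cl011 :: "real \<Rightarrow> cl011 \<Rightarrow> cl011" where
  "r *\<^sub>R x = Cl011 (r *\<^sub>R cl_fst x) (r *\<^sub>R cl_snd x)"

definition times_cl011 :: "cl011 \<Rightarrow> cl011 \<Rightarrow> cl011" where
  "x * y = Cl011 (cl_fst x * cl_fst y) (cl_fst x * cl_snd y + cl_snd x * cnj (cl_fst y))"

instance
  by standard
    (simp_all add: zero_cl011_def one_cl011_def plus_cl011_def uminus_cl011_def minus_cl011_def
      scaleR_cl011_def times_cl011_def cl011.expand algebra_simps)

end

definition cl_of_complex :: "complex \<Rightarrow> cl011" where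
  "cl_of_complex w = Cl011 w 0"

definition cl_delta :: cl011 where
  "cl_delta = Cl011 0 1"

definition cl_star :: "cl011 \<Rightarrow> cl011" where
  "cl_star x = Cl011 (cnj (cl_fst x)) (cl_snd x)"

lemmas cl011_defs = zero_cl011_def one_cl011_def plus_cl011_def uminus_cl011_def minus_cl011_def
  scaleR_cl011_def times_cl011_def cl_of_complex_def cl_delta_def cl_star_def

lemma Cl011_eq: "Cl011 w z = cl_of_complex w + cl_of_complex z * cl_delta"
  by (simp add: cl011_defs)

lemma cl011_ex1: "\<exists>!p. x = cl_of_complex (fst p) + cl_of_complex (snd p) * cl_delta"
  by (cases x) (auto simp: cl011_defs)

lemma cl_of_complex_hom:
  "cl_of_complex 1 = 1"
  "cl_of_complex (w + z) = cl_of_complex w + cl_of_complex z"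
  "cl_of_complex (w * z) = cl_of_complex w * cl_of_complex z"
  "cl_of_complex (r *\<^sub>R w) = r *\<^sub>R cl_of_complex w"
  by (simp_all add: cl011_defs)

lemma cl_delta_square: "cl_delta * cl_delta = 0"
  by (simp add: cl011_defs)

lemma cl_delta_commute: "cl_delta * cl_of_complex z = cl_of_complex (cnj z) * cl_delta"
  by (simp add: cl011_defs)

lemma cl_star_decomp:
  "cl_star (cl_of_complex w + cl_of_complex z * cl_delta)
    = cl_of_complex (cnj w) + cl_of_complex z * cl_delta"
  by (simp add: cl011_defs)

lemma cl_star_involution:
  "cl_star (cl_star x) = x"
  "cl_star 1 = 1"
  "cl_star (x + y) = cl_star x + cl_star y"
  "cl_star (r *\<^sub>R x) = r *\<^sub>R cl_star x"
  "cl_star (x * y) = cl_star y * cl_star x"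
  by (simp_all add: cl011_defs algebra_simps)

definition cl_adjoint :: "cl011 ^ 'n ^ 'm \<Rightarrow> cl011 ^ 'm ^ 'n" where
  "cl_adjoint M = (\<chi> i j. cl_star (M $ j $ i))"

definition cl_self_adjoint :: "cl011 ^ 'n ^ 'n \<Rightarrow> bool" where
  "cl_self_adjoint M \<longleftrightarrow> cl_adjoint M = M"

definition cl_unitary :: "cl011 ^ 'n ^ 'n \<Rightarrow> bool" where
  "cl_unitary U \<longleftrightarrow> invertible U \<and> cl_adjoint U = matrix_inv U"

text \<open>\<^const>\<open>matrix_inv\<close> is a Hilbert choice of a two-sided inverse, so over this
  noncommutative ring it is the inverse exactly when the matrix is \<^const>\<open>invertible\<close>.\<close>

lemma cl_unitary_iff:
  "cl_unitary U \<longleftrightarrow> U ** cl_adjoint U = mat 1 \<and> cl_adjoint U ** U = mat 1"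
proof
  assume "cl_unitary U"
  then have inv: "\<exists>V. U ** V = mat 1 \<and> V ** U = mat 1" and eq: "cl_adjoint U = matrix_inv U"
    by (auto simp: cl_unitary_def invertible_def)
  from someI_ex[OF inv] show "U ** cl_adjoint U = mat 1 \<and> cl_adjoint U ** U = mat 1"
    unfolding eq matrix_inv_def .
next
  assume A: "U ** cl_adjoint U = mat 1 \<and> cl_adjoint U ** U = mat 1"
  then have inv: "\<exists>V. U ** V = mat 1 \<and> V ** U = mat 1" by blast
  have "matrix_inv U ** U = mat 1"
    unfolding matrix_inv_def using someI_ex[OF inv] by blast
  then have "cl_adjoint U = matrix_inv U"
    using A by (metis matrix_mul_assoc matrix_mul_lid matrix_mul_rid)
  with inv show "cl_unitary U" by (simp add: cl_unitary_def invertible_def)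
qed

definition cl_diagonal :: "cl011 ^ 'n ^ 'n \<Rightarrow> bool" where
  "cl_diagonal D \<longleftrightarrow> (\<forall>i j. i \<noteq> j \<longrightarrow> D $ i $ j = 0)"

end

theory Submission
  imports Defs
begin

text \<open>
  Write \<open>H = A + B\<delta>\<close> with \<open>A\<close> Hermitian and \<open>B\<close> complex symmetric. Conjugation by a complex
  unitary \<open>V\<close> sends \<open>(A, B)\<close> to \<open>(VAV\<^sup>*, VBV\<^sup>T)\<close>. Maximise \<open>\<Sum>\<^sub>k c\<^sub>k Re (VAV\<^sup>*)\<^sub>k\<^sub>k\<close>, with distinct
  positive weights \<open>c\<^sub>k\<close>, over the compact unitary group: stationarity under rotations of two rows
  makes \<open>VAV\<^sup>*\<close> diagonal. Maximise \<open>\<Sum>\<^sub>k c\<^sub>k Re (VBV\<^sup>T)\<^sub>k\<^sub>k\<close> over the unitaries that achieve this with the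
  same eigenvalues \<open>\<lambda>\<close>: stationarity under the rotations inside an eigenspace kills the entries
  \<open>C\<^sub>i\<^sub>j\<close> of \<open>C = VBV\<^sup>T\<close> with \<open>\<lambda>\<^sub>i = \<lambda>\<^sub>j\<close>, \<open>i \<noteq> j\<close>. The remaining off-diagonal entries are removed by
  conjugation with \<open>1 + X\<delta>\<close>, where \<open>X\<^sub>i\<^sub>j = C\<^sub>i\<^sub>j / (\<lambda>\<^sub>i - \<lambda>\<^sub>j)\<close>; it is unitary because \<open>X\<close> is
  antisymmetric.
\<close>

section \<open>Complex matrices and the splitting \<open>A + B * delta\<close>\<close>

definition cnj_mat :: "complex ^ 'n ^ 'm \<Rightarrow> complex ^ 'n ^ 'm" where
  "cnj_mat M = (\<chi> i j. cnj (M $ i $ j))"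

definition hermite :: "complex ^ 'n ^ 'm \<Rightarrow> complex ^ 'm ^ 'n" where
  "hermite M = transpose (cnj_mat M)"

definition hdot :: "complex ^ 'n \<Rightarrow> complex ^ 'n \<Rightarrow> complex" where
  "hdot x y = (\<Sum>k\<in>UNIV. x $ k * cnj (y $ k))"

text \<open>Vectors are read as matrix rows, hence linearity in the first argument: at rows of
  \<open>V\<close> the values are the entries of \<open>V A V^*\<close>.\<close>

definition sesq :: "complex ^ 'n ^ 'n \<Rightarrow> complex ^ 'n \<Rightarrow> complex ^ 'n \<Rightarrow> complex" where
  "sesq A x y = (\<Sum>k\<in>UNIV. \<Sum>l\<in>UNIV. x $ k * A $ k $ l * cnj (y $ l))"

definition bilf :: "complex ^ 'n ^ 'n \<Rightarrow> complex ^ 'n \<Rightarrow> complex ^ 'n \<Rightarrow> complex" where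
  "bilf B x y = (\<Sum>k\<in>UNIV. \<Sum>l\<in>UNIV. x $ k * B $ k $ l * y $ l)"

definition clmat :: "complex ^ 'n ^ 'm \<Rightarrow> complex ^ 'n ^ 'm \<Rightarrow> cl011 ^ 'n ^ 'm" where
  "clmat A B = (\<chi> i j. Cl011 (A $ i $ j) (B $ i $ j))"

lemma cl_fst_sum: "cl_fst (sum f S) = (\<Sum>x\<in>S. cl_fst (f x))"
  by (induction S rule: infinite_finite_induct) (auto simp: cl011_defs)

lemma cl_snd_sum: "cl_snd (sum f S) = (\<Sum>x\<in>S. cl_snd (f x))"
  by (induction S rule: infinite_finite_induct) (auto simp: cl011_defs)

text \<open>Moving \<open>delta\<close> to the right past a complex matrix conjugates its entries,
  and the term with two factors \<open>delta\<close> vanishes.\<close>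

lemma clmat_mult:
  "clmat A B ** clmat C D = clmat (A ** C) (A ** D + B ** cnj_mat C)"
  by (auto simp: vec_eq_iff clmat_def matrix_matrix_mult_def cnj_mat_def cl_fst_sum cl_snd_sum
      times_cl011_def sum.distrib intro!: cl011.expand)

text \<open>The involution conjugates only the complex part. Hence self-adjointness splits into
  \<open>A\<close> Hermitian and \<open>B\<close> symmetric without conjugation.\<close>

lemma cl_adjoint_clmat: "cl_adjoint (clmat A B) = clmat (hermite A) (transpose B)"
  by (simp add: vec_eq_iff clmat_def cl_adjoint_def hermite_def cnj_mat_def transpose_def cl_star_def)

lemma cl_star_sum: "cl_star (sum f S) = (\<Sum>x\<in>S. cl_star (f x))"
  by (simp add: cl_star_def cl_fst_sum cl_snd_sum cl011.expand)

lemma cl_adjoint_mult: "cl_adjoint (M ** N) = cl_adjoint N ** cl_adjoint M"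
  by (simp add: vec_eq_iff cl_adjoint_def matrix_matrix_mult_def cl_star_sum cl_star_involution)

lemma mat_1_clmat: "mat 1 = clmat (mat 1) 0"
  by (simp add: vec_eq_iff clmat_def mat_def cl011_defs)

lemma clmat_surj: obtains A B where "M = clmat A B"
proof
  show "M = clmat (\<chi> i j. cl_fst (M $ i $ j)) (\<chi> i j. cl_snd (M $ i $ j))"
    by (simp add: vec_eq_iff clmat_def)
qed

lemma clmat_inject: "clmat A B = clmat C D \<longleftrightarrow> A = C \<and> B = D"
  by (auto simp: vec_eq_iff clmat_def)

lemma cnj_mat_mat_1 [simp]: "cnj_mat (mat 1) = mat 1"
  by (simp add: vec_eq_iff cnj_mat_def mat_def)

lemma hermite_mat_1 [simp]: "hermite (mat 1) = mat 1"
  by (simp add: hermite_def)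

lemma cnj_mat_hermite [simp]: "cnj_mat (hermite A) = transpose A"
  by (simp add: vec_eq_iff cnj_mat_def hermite_def transpose_def)

section \<open>Sesquilinear and bilinear forms on rows\<close>

lemma mult_hermite_component: "(V ** hermite W) $ i $ j = hdot (V $ i) (W $ j)"
  by (simp add: matrix_matrix_mult_def hermite_def cnj_mat_def transpose_def hdot_def)

lemma conj_hermite_component: "(V ** (A ** hermite V)) $ i $ j = sesq A (V $ i) (V $ j)"
  by (simp add: matrix_matrix_mult_def hermite_def cnj_mat_def transpose_def sesq_def
      sum_distrib_left mult.assoc)

lemma conj_transpose_component: "(V ** (B ** transpose V)) $ i $ j = bilf B (V $ i) (V $ j)"
  by (simp add: matrix_matrix_mult_def transpose_def bilf_def sum_distrib_left mult.assoc)

lemma scaleR_eq_vector_smult: "r *\<^sub>R x = complex_of_real r *s x" for x :: "complex ^ 'n"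
  by (simp add: vec_eq_iff) (simp add: scaleR_conv_of_real)

lemma hdot_simps [simp]:
  "hdot (x + y) z = hdot x z + hdot y z"
  "hdot (x - y) z = hdot x z - hdot y z"
  "hdot z (x + y) = hdot z x + hdot z y"
  "hdot z (x - y) = hdot z x - hdot z y"
  "hdot (c *s x) y = c * hdot x y"
  "hdot x (c *s y) = cnj c * hdot x y"
  by (simp_all add: hdot_def sum.distrib sum_subtractf sum_distrib_left algebra_simps)

lemma hdot_self: "hdot x x = (norm x)\<^sup>2"
  unfolding hdot_def norm_vec_def L2_set_def
  by (subst real_sqrt_pow2) (auto intro!: sum_nonneg simp: complex_norm_square simp del: of_real_power)

lemma sesq_simps [simp]:
  "sesq A (x + y) z = sesq A x z + sesq A y z"
  "sesq A z (x + y) = sesq A z x + sesq A z y"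
  "sesq A (c *s x) y = c * sesq A x y"
  "sesq A x (c *s y) = cnj c * sesq A x y"
  by (simp_all add: sesq_def sum.distrib sum_distrib_left algebra_simps)

lemma bilf_simps [simp]:
  "bilf A (x + y) z = bilf A x z + bilf A y z"
  "bilf A z (x + y) = bilf A z x + bilf A z y"
  "bilf A (c *s x) y = c * bilf A x y"
  "bilf A x (c *s y) = c * bilf A x y"
  by (simp_all add: bilf_def sum.distrib sum_distrib_left algebra_simps)

text \<open>Real scalars are fixed by conjugation, so the real part is real-bilinear; boundedness is
  automatic in finite dimension.\<close>

lemma bounded_bilinear_Re_sesq: "bounded_bilinear (\<lambda>x y. Re (sesq A x y))"
  unfolding bilinear_conv_bounded_bilinear[symmetric] bilinear_def
  by (auto intro!: linearI simp: scaleR_eq_vector_smult)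

lemma bounded_bilinear_Re_bilf: "bounded_bilinear (\<lambda>x y. Re (bilf A x y))"
  unfolding bilinear_conv_bounded_bilinear[symmetric] bilinear_def
  by (auto intro!: linearI simp: scaleR_eq_vector_smult)

lemma cnj_sesq:
  assumes "hermite A = A"
  shows "cnj (sesq A x y) = sesq A y x"
proof -
  have A: "cnj (A $ k $ l) = A $ l $ k" for k l
    using assms by (metis (no_types, lifting) cnj_mat_def hermite_def transpose_def vec_lambda_beta)
  have "cnj (sesq A x y) = (\<Sum>k\<in>UNIV. \<Sum>l\<in>UNIV. y $ l * A $ l $ k * cnj (x $ k))"
    by (simp add: sesq_def A algebra_simps)
  also have "\<dots> = sesq A y x"
    unfolding sesq_def by (rule sum.swap)
  finally show ?thesis .
qed

lemma bilf_commute: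
  assumes "transpose B = B"
  shows "bilf B x y = bilf B y x"
proof -
  have B: "B $ k $ l = B $ l $ k" for k l
    using assms by (metis (no_types, lifting) transpose_def vec_lambda_beta)
  have "bilf B x y = (\<Sum>k\<in>UNIV. \<Sum>l\<in>UNIV. y $ l * B $ l $ k * x $ k)"
    by (simp add: bilf_def B algebra_simps)
  also have "\<dots> = bilf B y x"
    unfolding bilf_def by (rule sum.swap)
  finally show ?thesis .
qed

section \<open>Orthonormal eigenframes and their rotations\<close>

text \<open>The case \<open>A = 0\<close>, \<open>l = 0\<close> gives the whole unitary group.\<close>

definition eigenframes :: "complex ^ 'n ^ 'n \<Rightarrow> ('n \<Rightarrow> complex) \<Rightarrow> (complex ^ 'n ^ 'n) set" where
  "eigenframes A l = {V. (\<forall>i j. hdot (V $ i) (V $ j) = (if i = j then 1 else 0))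
                       \<and> (\<forall>i. V $ i v* A = l i *s V $ i)}"

text \<open>The defining equations are continuous, so the set is closed; it is bounded because every
  row has norm 1.\<close>

lemma compact_eigenframes: "compact (eigenframes A l)"
proof -
  have "closed (eigenframes A l)"
    unfolding eigenframes_def hdot_def vector_matrix_mult_def vec_eq_iff vector_smult_component
    by (intro closed_Collect_conj closed_Collect_all closed_Collect_eq continuous_intros)
  moreover have "norm V \<le> (\<Sum>i\<in>(UNIV::'a set). 1)" if "V \<in> eigenframes A l" for V
  proof -
    have "complex_of_real ((norm (V $ i))\<^sup>2) = 1" for i
      using that unfolding hdot_self[symmetric] by (simp add: eigenframes_def)
    then have "(norm (V $ i))\<^sup>2 = 1" for i
      using of_real_eq_1_iff by blast
    then have "norm (V $ i) = 1" for i
      by (simp add: power2_eq_1_iff) (metis norm_ge_zero not_one_le_zero le_minus_one_simps(3) power2_eq_1_iff)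
    moreover have "norm V \<le> (\<Sum>i\<in>UNIV. norm (V $ i))"
      unfolding norm_vec_def by (rule L2_set_le_sum) auto
    ultimately show ?thesis by simp
  qed
  then have "bounded (eigenframes A l)"
    by (auto simp: bounded_iff)
  ultimately show ?thesis
    by (simp add: compact_eq_bounded_closed)
qed

text \<open>For \<open>i \<noteq> j\<close> and \<open>norm e = 1\<close> this is
  \<open>exp (t K) V\<close>, where \<open>K\<close> is the skew-Hermitian matrix with
  \<open>e\<close> at \<open>(i, j)\<close>, \<open>- cnj e\<close> at \<open>(j, i)\<close> and 0
  elsewhere.\<close>

definition rot :: "'n \<Rightarrow> 'n \<Rightarrow> complex \<Rightarrow> real \<Rightarrow> complex ^ 'n ^ 'n \<Rightarrow> complex ^ 'n ^ 'n" where
  "rot i j e t V = (\<chi> k.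
     if k = i then cos t *\<^sub>R V $ i + sin t *\<^sub>R (e *s V $ j)
     else if k = j then cos t *\<^sub>R V $ j - sin t *\<^sub>R (cnj e *s V $ i)
     else V $ k)"

text \<open>The rotation is unitary, and as \<open>l i = l j\<close> it only mixes eigenvectors of
  the same eigenvalue.\<close>

lemma rot_eigenframes:
  assumes V: "V \<in> eigenframes A l" and ij: "i \<noteq> j" "l i = l j" and e: "norm e = 1"
  shows "rot i j e t V \<in> eigenframes A l"
proof -
  have on: "hdot (V $ a) (V $ b) = (if a = b then 1 else 0)" and ev: "V $ a v* A = l a *s V $ a" for a b
    using V by (auto simp: eigenframes_def)
  have ee: "e * cnj e = 1"
    using e by (simp add: complex_norm_square[symmetric])
  have cs: "complex_of_real (cos t) * cos t + complex_of_real (sin t) * sin t = 1"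
    unfolding of_real_mult[symmetric] of_real_add[symmetric]
    by (metis of_real_1 power2_eq_square sin_cos_squared_add2)
  have phase: "x * (e * (x * cnj e)) = x * x" "x * (cnj e * (x * e)) = x * x" for x
  proof -
    have "x * (e * (x * cnj e)) = x * x * (e * cnj e)" "x * (cnj e * (x * e)) = x * x * (e * cnj e)"
      by (simp_all only: mult_ac)
    then show "x * (e * (x * cnj e)) = x * x" "x * (cnj e * (x * e)) = x * x"
      by (simp_all only: ee mult_1_right)
  qed
  have *: "complex_of_real (cos t) * cos t + complex_of_real (sin t) * (e * (sin t * cnj e)) = 1"
    "complex_of_real (cos t) * cos t + complex_of_real (sin t) * (cnj e * (sin t * e)) = 1"
    by (simp_all only: phase cs)
  have "hdot (rot i j e t V $ a) (rot i j e t V $ b) = (if a = b then 1 else 0)" for a b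
    using ij(1) * by (auto simp: rot_def on scaleR_eq_vector_smult algebra_simps)
  moreover have "rot i j e t V $ a v* A = l a *s rot i j e t V $ a" for a
  proof -
    have sc: "(c *s x) v* A = c *s (x v* A)"
      "(x + y) v* A = x v* A + y v* A" "(x - y) v* A = x v* A - y v* A" for c x y
      by (simp_all add: vec_eq_iff vector_matrix_mult_def sum_distrib_left sum.distrib sum_subtractf
          algebra_simps)
    show ?thesis
      by (auto simp: rot_def ev sc ij(2) scaleR_eq_vector_smult vec_eq_iff algebra_simps)
  qed
  ultimately show ?thesis by (simp add: eigenframes_def)
qed

text \<open>A maximiser of the weighted sum exists by compactness; the identity says that its
  derivative along each rotation vanishes at \<open>t = 0\<close>.\<close>

lemma exists_stationary_eigenframe:
  fixes S :: "complex ^ 'n \<Rightarrow> complex ^ 'n \<Rightarrow> real" and c :: "'n \<Rightarrow> real"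
  assumes ne: "eigenframes A l \<noteq> {}" and S: "bounded_bilinear S" and sym: "\<And>x y. S x y = S y x"
  obtains V where "V \<in> eigenframes A l"
    "\<And>i j e. i \<noteq> j \<Longrightarrow> l i = l j \<Longrightarrow> norm e = 1 \<Longrightarrow>
       c i * S (V $ i) (e *s V $ j) = c j * S (V $ j) (cnj e *s V $ i)"
proof -
  interpret S: bounded_bilinear S by (rule S)
  define f where "f V = (\<Sum>k\<in>UNIV. c k * S (V $ k) (V $ k))" for V :: "complex ^ 'n ^ 'n"
  have "continuous_on (eigenframes A l) f"
    unfolding f_def by (intro continuous_intros S.continuous_on)
  then obtain V where V: "V \<in> eigenframes A l" and max: "\<And>W. W \<in> eigenframes A l \<Longrightarrow> f W \<le> f V"
    using continuous_attains_sup[OF compact_eigenframes ne] by blast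
  have "c i * S (V $ i) (e *s V $ j) = c j * S (V $ j) (cnj e *s V $ i)"
    if ij: "i \<noteq> j" "l i = l j" and e: "norm e = 1" for i j e
  proof -
    define g where "g t = f (rot i j e t V)" for t
    define R where "R = (\<Sum>k\<in>UNIV - {i} - {j}. c k * S (V $ k) (V $ k))"
    let ?x = "V $ i" and ?y = "V $ j" and ?u = "e *s V $ j" and ?v = "cnj e *s V $ i"
    have g: "g t = c i * ((cos t)\<^sup>2 * S ?x ?x + 2 * cos t * sin t * S ?x ?u + (sin t)\<^sup>2 * S ?u ?u)
      + c j * ((cos t)\<^sup>2 * S ?y ?y - 2 * cos t * sin t * S ?y ?v + (sin t)\<^sup>2 * S ?v ?v) + R" for t
    proof -
      have "g t = c i * S (rot i j e t V $ i) (rot i j e t V $ i)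
        + (c j * S (rot i j e t V $ j) (rot i j e t V $ j)
        + (\<Sum>k\<in>UNIV - {i} - {j}. c k * S (rot i j e t V $ k) (rot i j e t V $ k)))"
        unfolding g_def f_def using ij(1)
        by (subst sum.remove[of _ i], simp, simp, subst sum.remove[of _ j]) auto
      moreover have "(\<Sum>k\<in>UNIV - {i} - {j}. c k * S (rot i j e t V $ k) (rot i j e t V $ k)) = R"
        unfolding R_def by (intro sum.cong) (auto simp: rot_def)
      moreover have "S (rot i j e t V $ i) (rot i j e t V $ i)
        = (cos t)\<^sup>2 * S ?x ?x + 2 * cos t * sin t * S ?x ?u + (sin t)\<^sup>2 * S ?u ?u"
        using sym[of ?u ?x]
        by (simp add: rot_def S.add_left S.add_right S.scaleR_left S.scaleR_right power2_eq_square
            algebra_simps)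
      moreover have "S (rot i j e t V $ j) (rot i j e t V $ j)
        = (cos t)\<^sup>2 * S ?y ?y - 2 * cos t * sin t * S ?y ?v + (sin t)\<^sup>2 * S ?v ?v"
        using sym[of ?v ?y] ij(1)
        by (simp add: rot_def S.diff_left S.diff_right S.scaleR_left S.scaleR_right power2_eq_square
            algebra_simps)
      ultimately show ?thesis by simp
    qed
    \<comment> \<open>At 0 only the cross terms in \<open>cos t * sin t\<close> contribute, as
      \<open>(cos t)^2\<close> and \<open>(sin t)^2\<close> have derivative 0 there.\<close>
    have "(g has_real_derivative (c i * (2 * S ?x ?u) - c j * (2 * S ?y ?v))) (at 0)"
      unfolding g by (auto intro!: derivative_eq_intros)
    moreover have "g t \<le> g 0" for t
    proof -
      have "rot i j e 0 V = V" by (auto simp: rot_def vec_eq_iff)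
      then show ?thesis
        unfolding g_def using max[OF rot_eigenframes[OF V ij e]] by simp
    qed
    ultimately have "c i * (2 * S ?x ?u) - c j * (2 * S ?y ?v) = 0"
      by (intro DERIV_local_max[of g _ 0 1]) auto
    then show ?thesis by simp
  qed
  with V show thesis by (rule that)
qed

section \<open>Simultaneous reduction of the Hermitian and the symmetric part\<close>

text \<open>The spectral theorem for \<open>A\<close> leaves the choice of an orthonormal basis in
  each eigenspace; this freedom is spent on a Takagi diagonalisation of the corresponding block of
  \<open>B\<close>.\<close>

lemma unitary_diagonalisation_with_takagi:
  fixes A B :: "complex ^ 'n ^ 'n"
  assumes A: "hermite A = A" and B: "transpose B = B"
  obtains V and l :: "'n \<Rightarrow> real" where
    "V ** hermite V = mat 1"
    "\<And>i j. (V ** (A ** hermite V)) $ i $ j = (if i = j then complex_of_real (l i) else 0)"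
    "\<And>i j. i \<noteq> j \<Longrightarrow> l i = l j \<Longrightarrow> (V ** (B ** transpose V)) $ i $ j = 0"
proof -
  \<comment> \<open>An injective numbering shifted by one gives weights that are distinct and
    positive.\<close>
  obtain h :: "'n \<Rightarrow> nat" where h: "inj h"
    using finite_imp_inj_to_nat_seg[OF finite_class.finite_UNIV] by blast
  define c where "c k = real (Suc (h k))" for k
  have c: "c i \<noteq> c j" if "i \<noteq> j" for i j
    using h that by (simp add: c_def inj_eq)
  have cpos: "c i > 0" for i by (simp add: c_def)
  have unitary: "V ** hermite V = mat 1 \<and> hermite V ** V = mat 1" if "V \<in> eigenframes C m" for V C m
  proof -
    have "V ** hermite V = mat 1"
      using that by (simp add: vec_eq_iff mult_hermite_component mat_def eigenframes_def)
    then show ?thesis using matrix_left_right_inverse by blast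
  qed
  have "mat 1 \<in> eigenframes (0 :: complex ^ 'n ^ 'n) (\<lambda>_. 0)"
    by (simp add: eigenframes_def flip: mult_hermite_component)
      (simp add: mat_def vector_matrix_mult_def vec_eq_iff)
  then have "eigenframes (0 :: complex ^ 'n ^ 'n) (\<lambda>_. 0) \<noteq> {}" by blast
  moreover have "Re (sesq A x y) = Re (sesq A y x)" for x y
    by (metis cnj_sesq[OF A] cnj.simps(1))
  ultimately obtain V where V: "V \<in> eigenframes (0 :: complex ^ 'n ^ 'n) (\<lambda>_. 0)"
    and st: "\<And>i j e. i \<noteq> j \<Longrightarrow> norm e = 1 \<Longrightarrow>
       c i * Re (sesq A (V $ i) (e *s V $ j)) = c j * Re (sesq A (V $ j) (cnj e *s V $ i))"
    by (rule exists_stationary_eigenframe[OF _ bounded_bilinear_Re_sesq[of A], where c = c]) simp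
  \<comment> \<open>The phases \<open>1\<close> and \<open>\<i>\<close> detect the real and the imaginary part of the off-diagonal entry.\<close>
  have off: "sesq A (V $ i) (V $ j) = 0" if "i \<noteq> j" for i j
  proof -
    have "sesq A (V $ j) (V $ i) = cnj (sesq A (V $ i) (V $ j))" by (simp add: cnj_sesq[OF A])
    then have "c i * Re (sesq A (V $ i) (V $ j)) = c j * Re (sesq A (V $ i) (V $ j))"
      and "c i * Im (sesq A (V $ i) (V $ j)) = c j * Im (sesq A (V $ i) (V $ j))"
      using st[OF that, of 1, unfolded sesq_simps] st[OF that, of \<i>, unfolded sesq_simps] by simp_all
    then show ?thesis using c[OF that] by (simp add: complex_eq_iff)
  qed
  define l where "l i = Re (sesq A (V $ i) (V $ i))" for i
  have diag: "sesq A (V $ i) (V $ i) = complex_of_real (l i)" for i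
    using cnj_sesq[OF A, of "V $ i" "V $ i"] by (simp add: l_def complex_eq_iff)
  define L :: "complex ^ 'n ^ 'n" where "L = (\<chi> i j. if i = j then complex_of_real (l i) else 0)"
  have L: "V ** (A ** hermite V) = L"
    by (simp add: vec_eq_iff conj_hermite_component L_def off diag)
  \<comment> \<open>Row by row this says that the rows of \<open>V\<close> are left eigenvectors of
    \<open>A\<close>, so \<open>V\<close> shows that the domain of the second maximisation is
    nonempty.\<close>
  have "V ** A = L ** V"
    using unitary[OF V] by (simp flip: L matrix_mul_assoc)
  have LW: "(L ** W) $ i = complex_of_real (l i) *s W $ i" and row: "(W ** A) $ i = W $ i v* A" for W i
    by (simp_all add: vec_eq_iff L_def matrix_matrix_mult_def vector_matrix_mult_def if_distribR
        if_distrib mult.commute cong: if_cong)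
  have "V \<in> eigenframes A (\<lambda>i. complex_of_real (l i))"
    using V \<open>V ** A = L ** V\<close> by (simp add: eigenframes_def flip: LW row)
  then have "eigenframes A (\<lambda>i. complex_of_real (l i)) \<noteq> {}" by blast
  moreover have "Re (bilf B x y) = Re (bilf B y x)" for x y
    by (simp add: bilf_commute[OF B, of x])
  ultimately obtain W where W: "W \<in> eigenframes A (\<lambda>i. complex_of_real (l i))"
    and st': "\<And>i j e. i \<noteq> j \<Longrightarrow> l i = l j \<Longrightarrow> norm e = 1 \<Longrightarrow>
       c i * Re (bilf B (W $ i) (e *s W $ j)) = c j * Re (bilf B (W $ j) (cnj e *s W $ i))"
    by (rule exists_stationary_eigenframe[OF _ bounded_bilinear_Re_bilf[of B], where c = c]) simp
  have "W ** A = L ** W"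
    using W by (subst vec_eq_iff) (simp add: eigenframes_def LW row)
  then have "W ** (A ** hermite W) = L"
    using unitary[OF W] by (metis matrix_mul_assoc matrix_mul_rid)
  moreover have "(W ** (B ** transpose W)) $ i $ j = 0" if ij: "i \<noteq> j" "l i = l j" for i j
  proof -
    \<comment> \<open>The second argument is now linear, so the phase \<open>\<i>\<close> yields the
      sum of the weights instead of their difference; positivity makes it nonzero.\<close>
    have "bilf B (W $ j) (W $ i) = bilf B (W $ i) (W $ j)" by (rule bilf_commute[OF B])
    then have "c i * Re (bilf B (W $ i) (W $ j)) = c j * Re (bilf B (W $ i) (W $ j))"
      and "(c i + c j) * Im (bilf B (W $ i) (W $ j)) = 0"
      using st'[OF ij, of 1, unfolded bilf_simps] st'[OF ij, of \<i>, unfolded bilf_simps]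
      by (simp_all add: algebra_simps)
    then show ?thesis
      using c[OF ij(1)] cpos[of i] cpos[of j] by (simp add: conj_transpose_component complex_eq_iff)
  qed
  ultimately show thesis
    using unitary[OF W] by (intro that[of W l]) (auto simp: L_def)
qed

section \<open>Diagonalisation over the Clifford algebra\<close>

theorem theorem8p1:
  fixes H :: "cl011 ^ 'n ^ 'n"
  assumes "cl_self_adjoint H"
  shows "\<exists>U D :: cl011 ^ 'n ^ 'n.
           cl_unitary U \<and> cl_diagonal D \<and> H = U ** D ** cl_adjoint U"
proof -
  obtain A B where H: "H = clmat A B" by (rule clmat_surj)
  have A: "hermite A = A" and B: "transpose B = B"
    using assms by (auto simp: H cl_self_adjoint_def cl_adjoint_clmat clmat_inject)
  obtain V and l :: "'n \<Rightarrow> real" where V: "V ** hermite V = mat 1"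
    and diag: "\<And>i j. (V ** (A ** hermite V)) $ i $ j = (if i = j then complex_of_real (l i) else 0)"
    and blocks: "\<And>i j. i \<noteq> j \<Longrightarrow> l i = l j \<Longrightarrow> (V ** (B ** transpose V)) $ i $ j = 0"
    using unitary_diagonalisation_with_takagi[OF A B] by blast
  define L where "L = V ** (A ** hermite V)"
  have L_component: "L $ i $ j = (if i = j then complex_of_real (l i) else 0)" for i j
    by (simp add: L_def diag)
  define C where "C = V ** (B ** transpose V)"
  \<comment> \<open>\<open>X $ i $ j = 0\<close> when \<open>l i = l j\<close>, by division by zero.\<close>
  define X :: "complex ^ 'n ^ 'n" where "X = (\<chi> i j. C $ i $ j / complex_of_real (l i - l j))"
  define P where "P = clmat (mat 1) X"
  define Q where "Q = clmat V 0"
  have V': "hermite V ** V = mat 1" using V matrix_left_right_inverse by blast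
  have C: "C $ i $ j = C $ j $ i" for i j
    by (simp add: C_def conj_transpose_component bilf_commute[OF B])
  \<comment> \<open>\<open>C\<close> is symmetric, while the denominator changes sign when
    \<open>i\<close> and \<open>j\<close> are exchanged.\<close>
  have X: "transpose X = - X"
    by (auto simp: vec_eq_iff transpose_def X_def C[of j for j] minus_divide_right simp flip: of_real_minus)
  have t0: "transpose (0 :: complex ^ 'n ^ 'n) = 0" by (simp add: transpose_def vec_eq_iff)
  have P: "P ** cl_adjoint P = mat 1" "cl_adjoint P ** P = mat 1"
    by (simp_all add: P_def cl_adjoint_clmat clmat_mult X mat_1_clmat)
  have Q: "Q ** cl_adjoint Q = mat 1" "cl_adjoint Q ** Q = mat 1"
    by (simp_all add: Q_def cl_adjoint_clmat clmat_mult t0 V V' mat_1_clmat)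
  \<comment> \<open>Passing \<open>delta\<close> across \<open>hermite V\<close> turns it into
    \<open>transpose V\<close>: \<open>A\<close> undergoes a similarity, \<open>B\<close> a
    congruence.\<close>
  have QH: "Q ** H ** cl_adjoint Q = clmat L C"
    by (simp add: Q_def H cl_adjoint_clmat clmat_mult t0 L_def C_def matrix_mul_assoc)
  define D where "D = P ** (Q ** H ** cl_adjoint Q) ** cl_adjoint P"
  have D: "D = clmat L (L ** transpose X + (C + X ** cnj_mat L))"
    by (simp add: D_def QH P_def cl_adjoint_clmat clmat_mult)
  have "cl_diagonal D"
    unfolding cl_diagonal_def
  proof (intro allI impI)
    fix i j :: 'n assume ij: "i \<noteq> j"
    \<comment> \<open>Since \<open>L\<close> is real, the \<open>delta\<close> coefficient of
      \<open>D\<close> at \<open>(i, j)\<close> is \<open>C_ij - (l i - l j) X_ij\<close>.\<close>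
    have "(L ** transpose X) $ i $ j = - (l i * X $ i $ j)"
      by (simp add: X matrix_matrix_mult_def L_component if_distribR if_distrib cong: if_cong)
    moreover have "(X ** cnj_mat L) $ i $ j = X $ i $ j * l j"
      by (simp add: matrix_matrix_mult_def cnj_mat_def L_component if_distribR if_distrib cong: if_cong)
    \<comment> \<open>If \<open>l i = l j\<close>, both sides are 0, the right one by
      \<open>blocks\<close>; otherwise the division cancels.\<close>
    moreover have "X $ i $ j * (l i - l j) = C $ i $ j"
      using blocks[OF ij] by (auto simp: X_def C_def)
    ultimately show "D $ i $ j = 0"
      using ij by (simp add: D clmat_def zero_cl011_def L_component algebra_simps)
  qed
  have adj: "cl_adjoint (cl_adjoint M) = M" for M :: "cl011 ^ 'n ^ 'n"
    by (simp add: cl_adjoint_def vec_eq_iff cl_star_involution)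
  \<comment> \<open>\<open>D = (P Q) H (P Q)^*\<close> with \<open>P Q\<close> unitary, so solving
    for \<open>H\<close> forces \<open>U = (P Q)^*\<close>.\<close>
  define U where "U = cl_adjoint Q ** cl_adjoint P"
  have U: "cl_adjoint U = P ** Q"
    by (simp add: U_def cl_adjoint_mult adj)
  have "U ** cl_adjoint U = mat 1"
    by (metis P(2) Q(2) U U_def matrix_mul_assoc matrix_mul_rid)
  moreover have "cl_adjoint U ** U = mat 1"
    by (metis P(1) Q(1) U U_def matrix_mul_assoc matrix_mul_rid)
  moreover have "H = U ** D ** cl_adjoint U"
  proof -
    have "D = cl_adjoint U ** H ** U"
      unfolding U unfolding D_def U_def by (simp add: matrix_mul_assoc)
    then have "U ** D ** cl_adjoint U = (U ** cl_adjoint U) ** H ** (U ** cl_adjoint U)"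
      by (simp add: matrix_mul_assoc)
    then show ?thesis using \<open>U ** cl_adjoint U = mat 1\<close> by simp
  qed
  ultimately show ?thesis
    using \<open>cl_diagonal D\<close> cl_unitary_iff by blast
qed

end
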